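(* Let $p$ be analytic in $\mathbb{D}$ with $p(0)=1$, let $\beta_0=3.58095$, and let $\beta$ be a real number with $\beta>\beta_0$. If $$p(z)+\frac{\beta zp'(z)}{p^4(z)}\prec\sqrt{1+z},$$ then $p(z)\prec\sqrt{1+z}$.
   Context: $\mathbb{D}=\{z\in\mathbb{C}:|z|<1\}$; $p^k(z)=(p(z))^k$. For analytic $f,g$ on $\mathbb{D}$, $f\prec g$ ($f$ is subordinate to $g$) means there is an analytic $w:\mathbb{D}\to\mathbb{D}$ with $w(0)=0$ and $f(z)=g(w(z))$ for all $z\in\mathbb{D}$; in particular the left-hand side of a subordination is understood to be an analytic function on $\mathbb{D}$. $\sqrt{1+z}$ is the principal branch; it maps $\mathbb{D}$ univalently onto $\{w:|w^2-1|<1,\ \operatorname{Re}w>0\}$. *)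

theory Defs
  imports "HOL-Complex_Analysis.Complex_Analysis"
begin

abbreviation unit_disc :: "complex set" where
  "unit_disc \<equiv> ball 0 1"

text \<open>
  Only the values on the unit disc matter. Holomorphy of both functions is part of the
  definition. In particular, if \<^term>\<open>f\<close> is given by an expression containing a quotient, then
  \<^term>\<open>subordinate f g\<close> says that this expression is analytic on the disc. The convention
  \<open>x / 0 = 0\<close> cannot hide a pole.
\<close>

definition subordinate :: "(complex \<Rightarrow> complex) \<Rightarrow> (complex \<Rightarrow> complex) \<Rightarrow> bool" where
  "subordinate f g \<longleftrightarrow>
     f holomorphic_on unit_disc \<and> g holomorphic_on unit_disc \<and>
     (\<exists>w. w holomorphic_on unit_disc \<and> w ` unit_disc \<subseteq> unit_disc \<and> w 0 = 0 \<and>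
          (\<forall>z\<in>unit_disc. f z = g (w z)))"

end

theory Submission
  imports Defs
begin

text \<open>
  The left-hand side of the hypothesis has no pole, so \<open>p\<close> has no zero. Put \<open>w = p\<^sup>2 - 1\<close>. If
  \<open>\<bar>w\<bar> < 1\<close> fails somewhere on the disc, Jack's lemma gives a point \<open>z\<close> with \<open>\<bar>w z\<bar> = 1\<close> and
  \<open>z w'(z) = m w(z)\<close>, \<open>m \<ge> 1\<close>. There the left-hand side equals \<open>q + k \<zeta> / q\<^sup>5\<close> with \<open>q = p z\<close>,
  \<open>\<zeta> = w z = q\<^sup>2 - 1\<close> and \<open>k = \<beta> m / 2\<close>, and this value lies outside the lemniscate, a contradiction.
  Hence \<open>\<bar>p\<^sup>2 - 1\<bar> < 1\<close>, which forces \<open>Re p > 0\<close> and \<open>p = csqrt (1 + w)\<close>.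
\<close>

section \<open>Boundary Schwarz estimate and Jack's lemma\<close>

lemma has_vector_derivative_inner_self:
  fixes f :: "real \<Rightarrow> 'a::real_inner"
  assumes "(f has_vector_derivative v) (at t)"
  shows "((\<lambda>s. f s \<bullet> f s) has_real_derivative 2 * (f t \<bullet> v)) (at t)"
  using has_derivative_inner[OF assms[unfolded has_vector_derivative_def] assms[unfolded has_vector_derivative_def]]
  unfolding has_field_derivative_def
  by (rule has_derivative_eq_rhs) (simp add: fun_eq_iff inner_commute)

text \<open>Schwarz's lemma bounds \<open>norm (g z)\<close> by \<open>norm z\<close>, with equality
  at 1. Complex differentiability at 1 lets this be tested along every inward direction: the radial
  one gives \<open>Re m \<ge> 1\<close>, an oblique one \<open>Im m = 0\<close>.\<close>

lemma jack_normalised: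
  fixes g :: "complex \<Rightarrow> complex"
  assumes hol: "g holomorphic_on ball 0 1" and "g 0 = 0"
    and lt: "\<And>z. norm z < 1 \<Longrightarrow> norm (g z) < 1"
    and g1: "g 1 = 1" and der: "(g has_field_derivative m) (at 1)"
  shows "m \<in> \<real> \<and> Re m \<ge> 1"
proof -
  have le: "norm (g z) \<le> norm z" if "norm z < 1" for z
    using Schwarz_Lemma(1)[OF hol \<open>g 0 = 0\<close> lt that] by simp
  \<comment> \<open>\<open>\<bar>g\<bar>\<^sup>2 - \<bar>z\<bar>\<^sup>2\<close> vanishes at 1 and is nonpositive in the disc, so its derivative at 1
    in each inward direction \<open>- d\<close> is nonpositive.\<close>
  have main: "Re ((m - 1) * d) \<ge> 0" if d: "Re d > 0" for d
  proof (rule ccontr)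
    assume neg: "\<not> Re ((m - 1) * d) \<ge> 0"
    define \<phi> where "\<phi> = (\<lambda>s::real. g (1 - of_real s * d))"
    define \<psi> where "\<psi> = (\<lambda>s::real. 1 - of_real s * d)"
    have \<psi>: "(\<psi> has_vector_derivative - d) (at 0)"
      unfolding \<psi>_def by (auto intro!: derivative_eq_intros)
    have \<phi>: "(\<phi> has_vector_derivative (- d * m)) (at 0)"
      using field_vector_diff_chain_at[OF \<psi>, of g m] der
      by (simp add: \<phi>_def \<psi>_def o_def)
    have D: "((\<lambda>s. \<phi> s \<bullet> \<phi> s - \<psi> s \<bullet> \<psi> s) has_real_derivative (- 2 * Re ((m - 1) * d))) (at 0)"
      using DERIV_diff[OF has_vector_derivative_inner_self[OF \<phi>] has_vector_derivative_inner_self[OF \<psi>]] g1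
      by (simp add: \<phi>_def \<psi>_def inner_complex_def algebra_simps)
    obtain e where e: "e > 0" "\<And>h. 0 < h \<Longrightarrow> h < e \<Longrightarrow> \<phi> h \<bullet> \<phi> h - \<psi> h \<bullet> \<psi> h > 0"
      using DERIV_pos_inc_right[OF D] neg g1 by (auto simp: \<phi>_def \<psi>_def)
    have "d \<noteq> 0" using d by auto
    \<comment> \<open>For \<open>\<psi> h\<close> to lie in the disc,
      \<open>h * (norm d)^2 < 2 * Re d\<close> is needed; the second entry of the minimum keeps it
      at most \<open>Re d\<close>.\<close>
    define h where "h = min (e / 2) (Re d / (norm d)\<^sup>2)"
    have h: "0 < h" "h < e" "h \<le> Re d / (norm d)\<^sup>2"
      using e d \<open>d \<noteq> 0\<close> by (auto simp: h_def)
    have "(norm (\<psi> h))\<^sup>2 = 1 - h * (2 * Re d - h * (norm d)\<^sup>2)"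
      unfolding cmod_power2 by (simp add: \<psi>_def power2_eq_square algebra_simps)
    moreover have "h * (norm d)\<^sup>2 \<le> Re d"
      using h(3) \<open>d \<noteq> 0\<close> by (simp add: field_simps)
    then have "h * (2 * Re d - h * (norm d)\<^sup>2) > 0"
      using d h(1) by simp
    ultimately have "(norm (\<psi> h))\<^sup>2 < 1\<^sup>2" by simp
    then have "norm (\<psi> h) < 1"
      by (rule power_less_imp_less_base) simp
    then have "norm (\<phi> h) \<le> norm (\<psi> h)"
      using le[of "\<psi> h"] by (simp add: \<phi>_def \<psi>_def)
    then have "\<phi> h \<bullet> \<phi> h \<le> \<psi> h \<bullet> \<psi> h"
      by (simp add: dot_square_norm power_mono)
    with e(2)[OF h(1,2)] show False by simp
  qed
  have re: "Re m \<ge> 1" using main[of 1] by simp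
  have "Im m = 0"
  proof (rule ccontr)
    assume "Im m \<noteq> 0"
    \<comment> \<open>In this direction \<open>Re ((m - 1) * d)\<close> equals -1.\<close>
    then show False
      using main[of "Complex 1 (Re m / Im m)"] by simp
  qed
  then show ?thesis using re by (simp add: complex_is_Real_iff)
qed

text \<open>Rescaling to \<open>w (z0 * z) / w z0\<close> moves the point to 1, where the derivative
  becomes \<open>z0 * deriv w z0 / w z0\<close>. The strict bound makes the rescaled map a self-map
  of the open disc, as Schwarz's lemma requires.\<close>

lemma jack:
  fixes w :: "complex \<Rightarrow> complex"
  assumes hol: "w holomorphic_on S" and S: "open S" "cball 0 (norm z0) \<subseteq> S" and "w 0 = 0"
    and lt: "\<And>z. norm z < norm z0 \<Longrightarrow> norm (w z) < norm (w z0)"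
  obtains m :: real where "m \<ge> 1" "z0 * deriv w z0 = of_real m * w z0"
proof (cases "z0 = 0")
  case True
  then show ?thesis using that[of 1] \<open>w 0 = 0\<close> by simp
next
  case False
  have w0: "w z0 \<noteq> 0"
    using lt[of 0] False \<open>w 0 = 0\<close> by auto
  define g where "g = (\<lambda>z. w (z0 * z) / w z0)"
  have sub: "(\<lambda>z. z0 * z) ` ball 0 1 \<subseteq> S"
    using S(2) by (force simp: norm_mult mult_le_cancel_left2)
  have ghol: "g holomorphic_on ball 0 1"
    unfolding g_def using w0 sub
    by (intro holomorphic_intros holomorphic_on_compose_gen[OF _ hol, unfolded o_def]) auto
  have z0S: "z0 \<in> S" using S(2) by auto
  have dw: "(w has_field_derivative deriv w z0) (at z0)"
    using holomorphic_derivI[OF hol S(1) z0S] .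
  have dg: "(g has_field_derivative (z0 * deriv w z0 / w z0)) (at 1)"
    unfolding g_def using w0 dw
    by (auto intro!: derivative_eq_intros DERIV_chain2[where f = w])
  have "z0 * deriv w z0 / w z0 \<in> \<real> \<and> Re (z0 * deriv w z0 / w z0) \<ge> 1"
  proof (rule jack_normalised[OF ghol _ _ _ dg])
    show "norm (g z) < 1" if "norm z < 1" for z
      using lt[of "z0 * z"] that False w0 by (simp add: g_def norm_divide norm_mult)
  qed (use w0 \<open>w 0 = 0\<close> in \<open>auto simp: g_def\<close>)
  then obtain m where "z0 * deriv w z0 / w z0 = of_real m" "m \<ge> 1"
    by (metis Reals_cases Re_complex_of_real)
  then show ?thesis using that[of m] w0 by (simp add: field_simps)
qed

section \<open>Minimal exit points and absence of zeros\<close>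

text \<open>A point of least modulus in the compact set where \<open>norm (w z) \<ge> 1\<close>
  works: it is a limit of points of smaller modulus, so by continuity the norm there is exactly
  1.\<close>

lemma first_exit_point:
  fixes w :: "complex \<Rightarrow> complex"
  assumes cont: "continuous_on (ball 0 R) w" and "w 0 = 0"
    and z1: "norm z1 < R" "norm (w z1) \<ge> 1"
  obtains z0 where "norm z0 < R" "norm (w z0) = 1" "\<And>z. norm z < norm z0 \<Longrightarrow> norm (w z) < 1"
proof -
  define K where "K = cball 0 (norm z1) \<inter> (\<lambda>z. norm (w z)) -` {1..}"
  have sub: "cball 0 (norm z1) \<subseteq> ball 0 R" using z1 by auto
  have c: "continuous_on (cball 0 (norm z1)) (\<lambda>z. norm (w z))"
    using continuous_on_subset[OF cont sub] by (intro continuous_intros)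
  have "closed K"
    unfolding K_def by (rule continuous_closed_preimage[OF c closed_cball closed_atLeast])
  then have "compact K"
    unfolding K_def by (metis bounded_cball bounded_subset compact_eq_bounded_closed inf_le1)
  moreover have "K \<noteq> {}" using z1 by (auto simp: K_def)
  ultimately obtain z0 where z0: "z0 \<in> K" "\<And>z. z \<in> K \<Longrightarrow> norm z0 \<le> norm z"
    using continuous_attains_inf[of K norm] continuous_on_norm_id by blast
  have lt: "norm (w z) < 1" if "norm z < norm z0" for z
    using z0(2)[of z] z0(1) that by (force simp: K_def)
  \<comment> \<open>Radius 0 has to be excluded, since the closure of an empty ball is not the
    closed ball.\<close>
  have "z0 \<noteq> 0" using z0(1) \<open>w 0 = 0\<close> by (auto simp: K_def)
  then have cl: "closure (ball (0::complex) (norm z0)) = cball 0 (norm z0)" by simp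
  have "continuous_on (cball 0 (norm z0)) (\<lambda>z. norm (w z))"
    by (rule continuous_on_subset[OF c]) (use z0(1) in \<open>auto simp: K_def\<close>)
  then have "norm (w z0) \<le> 1"
    using continuous_le_on_closure[of "ball 0 (norm z0)" "\<lambda>z. norm (w z)" z0 1] cl lt
    by (force simp: less_imp_le)
  then show ?thesis using that[of z0] z0(1) lt z1 by (auto simp: K_def)
qed

text \<open>At a zero of order \<open>n\<close> of \<open>p\<close> the quotient would have a pole of order \<open>3 n + 1\<close>.\<close>
lemma nonvanishing_if_quotient_continuous:
  fixes p :: "complex \<Rightarrow> complex"
  assumes hol: "p holomorphic_on S" and S: "open S" "connected S" "0 \<in> S" and "p 0 \<noteq> 0" "c \<noteq> 0"
    and cont: "continuous_on S (\<lambda>z. p z + c * z * deriv p z / (p z) ^ 4)" (is "continuous_on S ?P")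
    and "z1 \<in> S"
  shows "p z1 \<noteq> 0"
proof
  assume z1: "p z1 = 0"
  have nc: "\<not> p constant_on S"
    using z1 \<open>z1 \<in> S\<close> \<open>0 \<in> S\<close> \<open>p 0 \<noteq> 0\<close> unfolding constant_on_def by metis
  obtain g r n where n: "0 < n" and r: "0 < r" "ball z1 r \<subseteq> S" and g: "g holomorphic_on ball z1 r"
    and fac: "\<And>z. z \<in> ball z1 r \<Longrightarrow> p z = (z - z1) ^ n * g z"
    and gnz: "\<And>z. z \<in> ball z1 r \<Longrightarrow> g z \<noteq> 0"
    by (rule holomorphic_factor_zero_nonconstant[OF hol S(1,2) \<open>z1 \<in> S\<close> z1 nc]) blast
  have "z1 \<noteq> 0" using z1 \<open>p 0 \<noteq> 0\<close> by auto
  \<comment> \<open>Multiplying by \<open>(z - z1) ^ (3 * n + 1) * g z ^ 4\<close> clears the pole.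
    Both sides are continuous and agree off \<open>z1\<close>, but at \<open>z1\<close> the left is
    0 and the right is \<open>c * z1 * n * g z1\<close>.\<close>
  define L where "L = (\<lambda>z. (z - z1) ^ (3 * n + 1) * g z ^ 4 * (?P z - p z))"
  define R where "R = (\<lambda>z. c * z * (of_nat n * g z + (z - z1) * deriv g z))"
  have eq: "L z = R z" if z: "z \<in> ball z1 r" "z \<noteq> z1" for z
  proof -
    define u where "u = z - z1"
    have u: "u \<noteq> 0" using z by (simp add: u_def)
    have "((\<lambda>z. (z - z1) ^ n * g z) has_field_derivative
            of_nat n * u ^ (n - 1) * g z + u ^ n * deriv g z) (at z)"
      using holomorphic_derivI[OF g open_ball z(1)]
      by (auto intro!: derivative_eq_intros simp: u_def)
    then have "(p has_field_derivative of_nat n * u ^ (n - 1) * g z + u ^ n * deriv g z) (at z)"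
      by (rule has_field_derivative_transform_within_open[OF _ open_ball z(1)]) (simp add: fac)
    then have dp: "deriv p z = of_nat n * u ^ (n - 1) * g z + u ^ n * deriv g z"
      by (rule DERIV_imp_deriv)
    obtain k where k: "n = Suc k" using n by (cases n) auto
    have dp': "deriv p z = u ^ k * (of_nat n * g z + u * deriv g z)"
      unfolding dp by (simp add: k algebra_simps)
    \<comment> \<open>The factor \<open>u ^ k\<close> with \<open>k = n - 1\<close> cancels against
      \<open>deriv p z\<close>, leaving exponent \<open>4 * n - (n - 1)\<close>.\<close>
    have "(u ^ n) ^ 4 = u ^ k * u ^ (3 * n + 1)"
      unfolding power_mult[symmetric] power_add[symmetric] by (simp add: k algebra_simps)
    then have p4: "p z ^ 4 = u ^ k * (u ^ (3 * n + 1) * g z ^ 4)"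
      using fac[OF z(1)] by (simp add: u_def[symmetric] power_mult_distrib)
    have quot: "?P z - p z = c * z * (of_nat n * g z + u * deriv g z) / (u ^ (3 * n + 1) * g z ^ 4)"
      unfolding dp' p4 using u by (simp add: mult.assoc)
    show ?thesis
      unfolding L_def R_def quot u_def[symmetric] using u gnz[OF z(1)] by simp
  qed
  have z1b: "z1 \<in> ball z1 r" using r by simp
  have "continuous_on (ball z1 r) L"
    unfolding L_def
    by (intro continuous_intros holomorphic_on_imp_continuous_on[OF g]
        continuous_on_subset[OF cont r(2)]
        continuous_on_subset[OF holomorphic_on_imp_continuous_on[OF hol] r(2)])
  then have L: "L \<midarrow>z1\<rightarrow> L z1"
    using z1b by (simp add: continuous_on_eq_continuous_at isCont_def)
  have "continuous_on (ball z1 r) R"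
    unfolding R_def
    by (intro continuous_intros holomorphic_on_imp_continuous_on[OF g]
        holomorphic_on_imp_continuous_on[OF holomorphic_deriv[OF g open_ball]])
  then have R: "R \<midarrow>z1\<rightarrow> R z1"
    using z1b by (simp add: continuous_on_eq_continuous_at isCont_def)
  have "\<forall>\<^sub>F z in at z1. L z = R z"
    using eq r(1) by (auto simp: eventually_at dist_commute intro!: exI[of _ r])
  with L have "R \<midarrow>z1\<rightarrow> L z1" using tendsto_cong by blast
  then have "R z1 = L z1" using R by (metis LIM_unique)
  moreover have "L z1 = 0" "R z1 \<noteq> 0"
    using n gnz[OF z1b] \<open>z1 \<noteq> 0\<close> \<open>c \<noteq> 0\<close> by (auto simp: L_def R_def)
  ultimately show False by simp
qed

section \<open>The estimate on the lemniscate\<close>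

text \<open>Squaring removes the root \<open>q\<close>; the squared norm then becomes 1 plus
  \<open>k\<close> times a polynomial in \<open>k\<close> and \<open>u\<close> alone, which is
  nonnegative for \<open>k \<ge> 3 / 2\<close>.\<close>

lemma lemniscate_perturbation_norm_ge_1:
  fixes q \<zeta> :: complex and k :: real
  assumes q: "q\<^sup>2 = 1 + \<zeta>" and \<zeta>: "norm \<zeta> = 1" "\<zeta> \<noteq> -1" and k: "k \<ge> 3 / 2"
  shows "norm ((q + of_real k * \<zeta> / q ^ 5)\<^sup>2 - 1) \<ge> 1"
proof -
  define x y u where "x = Re \<zeta>" and "y = Im \<zeta>" and "u = 1 / (2 + 2 * x)"
  \<comment> \<open>\<open>u = 1 / \<bar>1 + \<zeta>\<bar>\<^sup>2 = \<zeta> / (1 + \<zeta>)\<^sup>2\<close> is real, which makes the whole expression explicit.\<close>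
  have xy: "x\<^sup>2 + y\<^sup>2 = 1" using \<zeta>(1) by (simp add: x_def y_def cmod_def)
  have "x \<noteq> -1"
    using xy \<zeta>(2) by (auto simp: x_def y_def complex_eq_iff)
  moreover have "x\<^sup>2 \<le> 1" using xy zero_le_power2[of y] by linarith
  ultimately have x: "x > -1" by (simp add: abs_square_le_1 abs_le_iff)
  then have u: "u > 0" "u * (2 + 2 * x) = 1" by (simp_all add: u_def)
  define s where "s = 1 + \<zeta>"
  have s: "s \<noteq> 0" "q\<^sup>2 = s"
    using q \<zeta>(2) by (auto simp: s_def add_eq_0_iff)
  then have "q \<noteq> 0" by auto
  have zs: "\<zeta> = of_real u * s\<^sup>2"
  proof -
    have "of_real (2 + 2 * x) * \<zeta> = s\<^sup>2"
      using xy by (simp add: complex_eq_iff s_def x_def[symmetric] y_def[symmetric] power2_eq_square algebra_simps)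
    then have "of_real (u * (2 + 2 * x)) * \<zeta> = of_real u * s\<^sup>2" by simp
    then show ?thesis unfolding u(2) by simp
  qed
  \<comment> \<open>This is \<open>cnj s\<close> divided by its squared norm, with
    \<open>u * (1 + x) = 1 / 2\<close>.\<close>
  have inv_s: "1 / s = Complex (1 / 2) (- y * u)"
  proof -
    have "s * Complex (1 / 2) (- y * u) = 1"
    proof (rule complex_eqI)
      have "y * y * u = (1 - x) * (u * (2 + 2 * x)) / 2"
        using xy by algebra
      then show "Re (s * Complex (1 / 2) (- y * u)) = Re 1"
        unfolding u(2) by (simp add: s_def x_def[symmetric] y_def[symmetric] field_simps)
      have "y * (u * (2 + 2 * x)) = y" unfolding u(2) by simp
      then show "Im (s * Complex (1 / 2) (- y * u)) = Im 1"
        by (simp add: s_def x_def[symmetric] y_def[symmetric] field_simps)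
    qed
    then show ?thesis using s(1) by (simp add: field_simps)
  qed
  have q5: "q ^ 5 = q * s\<^sup>2" "(q ^ 5)\<^sup>2 = s ^ 4 * s"
    unfolding s(2)[symmetric] by (simp_all flip: power_mult power_Suc power_Suc2 power_add)
  have "(q + of_real k * \<zeta> / q ^ 5)\<^sup>2 - 1
      = q\<^sup>2 + of_real k ^ 2 * (\<zeta>\<^sup>2 / (q ^ 5)\<^sup>2) + 2 * of_real k * (q * \<zeta> / q ^ 5) - 1"
    by (simp add: power2_sum power_divide power_mult_distrib)
  also have "q * \<zeta> / q ^ 5 = of_real u"
    unfolding q5(1) using s(1) \<open>q \<noteq> 0\<close> by (simp add: zs)
  also have "\<zeta>\<^sup>2 / (q ^ 5)\<^sup>2 = of_real u ^ 2 * (1 / s)"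
    unfolding q5(2) using s(1) by (simp add: zs power_mult_distrib flip: power_mult)
  also have "q\<^sup>2 + of_real k ^ 2 * (of_real u ^ 2 * (1 / s)) + 2 * of_real k * of_real u - 1
      = \<zeta> + 2 * of_real k * of_real u + of_real (k\<^sup>2 * u\<^sup>2) * (1 / s)"
    using q by simp
  also have "\<dots> = Complex (x + 2 * k * u + k\<^sup>2 * u\<^sup>2 / 2) (y * (1 - k\<^sup>2 * u ^ 3))"
    unfolding inv_s by (simp add: complex_eq_iff x_def y_def algebra_simps power2_eq_square power3_eq_cube)
  finally have eq: "(q + of_real k * \<zeta> / q ^ 5)\<^sup>2 - 1
      = Complex (x + 2 * k * u + k\<^sup>2 * u\<^sup>2 / 2) (y * (1 - k\<^sup>2 * u ^ 3))" .
  have "(x + 2 * k * u + k\<^sup>2 * u\<^sup>2 / 2)\<^sup>2 + (y * (1 - k\<^sup>2 * u ^ 3))\<^sup>2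
      = 1 + k * (2 - 4 * u + k * u + k * u\<^sup>2 + 2 * k\<^sup>2 * u ^ 3 + k ^ 3 * u ^ 5)"
  proof -
    \<comment> \<open>\<open>e1\<close> and \<open>e2\<close> eliminate \<open>x\<close> and
      \<open>y\<close> in favour of \<open>u\<close>.\<close>
    have e1: "2 * u * x = 1 - 2 * u" using u(2) by (simp add: algebra_simps)
    have "u\<^sup>2 * y\<^sup>2 = u * (u * (2 + 2 * x)) * (1 - x) / 2"
      using xy by algebra
    then have "u\<^sup>2 * y\<^sup>2 = u * (1 - x) / 2" unfolding u(2) by simp
    then have e2: "u\<^sup>2 * y\<^sup>2 = u - 1 / 4" using e1 by (simp add: algebra_simps)
    have "(x + 2 * k * u + k\<^sup>2 * u\<^sup>2 / 2)\<^sup>2 + (y * (1 - k\<^sup>2 * u ^ 3))\<^sup>2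
        = (x\<^sup>2 + y\<^sup>2) + (2 * k + k\<^sup>2 * u / 2) * (2 * u * x) + 4 * k\<^sup>2 * u\<^sup>2 + 2 * k ^ 3 * u ^ 3
          + k ^ 4 * u ^ 4 / 4 + (k ^ 4 * u ^ 4 - 2 * k\<^sup>2 * u) * (u\<^sup>2 * y\<^sup>2)"
      by (simp add: eval_nat_numeral field_simps)
    also have "\<dots> = 1 + k * (2 - 4 * u + k * u + k * u\<^sup>2 + 2 * k\<^sup>2 * u ^ 3 + k ^ 3 * u ^ 5)"
      unfolding xy e1 e2 by (simp add: eval_nat_numeral field_simps)
    finally show ?thesis .
  qed
  moreover have "2 - 4 * u + k * u + k * u\<^sup>2 + 2 * k\<^sup>2 * u ^ 3 + k ^ 3 * u ^ 5 \<ge> 0"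
  proof -
    \<comment> \<open>Only \<open>- 4 * u\<close> is negative. At \<open>k = 3 / 2\<close> the terms
      up to \<open>u^2\<close> already form a positive quadratic, and larger \<open>k\<close> only
      helps.\<close>
    have "2 - 4 * u + 3 / 2 * (u + u\<^sup>2) = 5 / 4 * (u - 1)\<^sup>2 + u\<^sup>2 / 4 + 3 / 4"
      by (simp add: power2_diff field_simps)
    then have "2 - 4 * u + 3 / 2 * (u + u\<^sup>2) \<ge> 0" by simp
    moreover have "3 / 2 * (u + u\<^sup>2) \<le> k * (u + u\<^sup>2)"
      using k u(1) by (intro mult_right_mono) auto
    moreover have "2 * k\<^sup>2 * u ^ 3 \<ge> 0" "k ^ 3 * u ^ 5 \<ge> 0" using k u(1) by auto
    ultimately show ?thesis unfolding distrib_left by linarith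
  qed
  ultimately show ?thesis
    unfolding eq using k by (simp add: cmod_def)
qed

section \<open>Proof of the subordination\<close>

theorem lemma3p3:
  fixes p :: "complex \<Rightarrow> complex" and \<beta> :: real
  assumes "p holomorphic_on unit_disc" and "p 0 = 1"
    and "\<beta> > 3.58095"
    and "subordinate (\<lambda>z. p z + of_real \<beta> * z * deriv p z / (p z) ^ 4) (\<lambda>z. csqrt (1 + z))"
  shows "subordinate p (\<lambda>z. csqrt (1 + z))"
proof -
  define P where "P = (\<lambda>z. p z + of_real \<beta> * z * deriv p z / (p z) ^ 4)"
  obtain v where P: "P holomorphic_on unit_disc" and q: "(\<lambda>z. csqrt (1 + z)) holomorphic_on unit_disc"
    and v: "v ` unit_disc \<subseteq> unit_disc" "\<And>z. z \<in> unit_disc \<Longrightarrow> P z = csqrt (1 + v z)"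
    using assms(4) unfolding subordinate_def P_def by blast
  have P_lt: "norm ((P z)\<^sup>2 - 1) < 1" if "z \<in> unit_disc" for z
    using v(1) that unfolding v(2)[OF that] by (simp add: image_subset_iff)
  have nz: "p z \<noteq> 0" if "z \<in> unit_disc" for z
    using nonvanishing_if_quotient_continuous[OF assms(1), of "of_real \<beta>" z] assms(2,3) that
      holomorphic_on_imp_continuous_on[OF P[unfolded P_def]] by simp
  define w where "w = (\<lambda>z. (p z)\<^sup>2 - 1)"
  have w: "w holomorphic_on unit_disc" "w 0 = 0"
    using assms(1,2) by (auto simp: w_def intro!: holomorphic_intros)
  have w_lt: "norm (w z) < 1" if "z \<in> unit_disc" for z
  proof (rule ccontr)
    assume "\<not> norm (w z) < 1"
    then have "norm (w z) \<ge> 1" by simp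
    moreover have "norm z < 1" using that by simp
    ultimately obtain z0 where z0: "norm z0 < 1" "norm (w z0) = 1"
      and lt: "\<And>z. norm z < norm z0 \<Longrightarrow> norm (w z) < 1"
      using first_exit_point[OF holomorphic_on_imp_continuous_on[OF w(1)] w(2)] by blast
    have "cball 0 (norm z0) \<subseteq> unit_disc" using z0(1) by auto
    then obtain m where m: "m \<ge> 1" "z0 * deriv w z0 = of_real m * w z0"
      using jack[OF w(1) open_ball _ w(2), of z0] lt unfolding z0(2) by blast
    have pz0: "p z0 \<noteq> 0" using nz z0(1) by simp
    have "(w has_field_derivative 2 * p z0 * deriv p z0) (at z0)"
      using holomorphic_derivI[OF assms(1) open_ball, of z0] z0(1)
      unfolding w_def by (auto intro!: derivative_eq_intros)
    then have "deriv w z0 = 2 * p z0 * deriv p z0" by (rule DERIV_imp_deriv)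
    then have "z0 * deriv p z0 = of_real m * w z0 / (2 * p z0)"
      using m(2) pz0 by (simp add: field_simps)
    then have "P z0 = p z0 + of_real \<beta> * (of_real m * w z0 / (2 * p z0)) / p z0 ^ 4"
      unfolding P_def by (simp add: mult.assoc)
    also have "\<dots> = p z0 + of_real (\<beta> * m / 2) * w z0 / p z0 ^ 5"
      by (simp add: eval_nat_numeral mult.assoc)
    finally have "P z0 = p z0 + of_real (\<beta> * m / 2) * w z0 / p z0 ^ 5" .
    moreover have "\<beta> * m / 2 \<ge> 3 / 2"
      using mult_mono[of 3 \<beta> 1 m] m(1) assms(3) by simp
    moreover have "w z0 \<noteq> -1" using pz0 by (simp add: w_def)
    ultimately have "norm ((P z0)\<^sup>2 - 1) \<ge> 1"
      using lemniscate_perturbation_norm_ge_1[of "p z0" "w z0" "\<beta> * m / 2"] z0(2)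
      by (simp add: w_def)
    then show False using P_lt[of z0] z0(1) by simp
  qed
  \<comment> \<open>Since \<open>Re (p 0) = 1\<close> and the disc is connected, a failure would
    produce a purely imaginary value of \<open>p\<close>; there \<open>w\<close> is real and at most
    -1.\<close>
  have Re_p: "Re (p z) > 0" if z: "z \<in> unit_disc" for z
  proof (rule ccontr)
    assume neg: "\<not> Re (p z) > 0"
    have "1 \<in> (\<lambda>z. Re (p z)) ` unit_disc"
      using assms(2) by (intro image_eqI[of _ _ 0]) auto
    moreover have "connected ((\<lambda>z. Re (p z)) ` unit_disc)"
      by (intro connected_continuous_image continuous_intros
          holomorphic_on_imp_continuous_on[OF assms(1)]) auto
    ultimately have "0 \<in> (\<lambda>z. Re (p z)) ` unit_disc"
      using connectedD_interval[of _ "Re (p z)" 1 0] z neg by auto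
    then obtain y where y: "y \<in> unit_disc" "Re (p y) = 0" by force
    then have "w y = of_real (- 1 - (Im (p y))\<^sup>2)"
      by (simp add: w_def complex_eq_iff power2_eq_square)
    then have "norm (w y) = \<bar>- 1 - (Im (p y))\<^sup>2\<bar>" by (simp only: norm_of_real)
    then show False using w_lt[OF y(1)] zero_le_power2[of "Im (p y)"] by linarith
  qed
  \<comment> \<open>Positivity of the real part selects the principal branch.\<close>
  have "p z = csqrt (1 + w z)" if "z \<in> unit_disc" for z
    using csqrt_square[of "p z"] Re_p[OF that] by (simp add: w_def)
  then show ?thesis
    unfolding subordinate_def using assms(1) q w w_lt by (auto intro!: exI[of _ w])
qed

end
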